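(* Let $(A,\cdot,\ast,\alpha)$ be a Hom-Novikov-Poisson algebra, and let $\beta\colon A\to A$ be a weak morphism. Define $x\cdot_\beta y=\beta(x\cdot y)$ and $x\ast_\beta y=\beta(x\ast y)$ for $x,y\in A$. Then $A_\beta=(A,\cdot_\beta,\ast_\beta,\beta\alpha)$ is also a Hom-Novikov-Poisson algebra. Moreover, if $A$ is multiplicative and $\beta$ is a morphism, then $A_\beta$ is also multiplicative.
   Context: Everything is over a fixed field $\mathbf{k}$ of characteristic $0$. A double Hom-algebra is a quadruple $(A,\cdot,\ast,\alpha)$ where $A$ is a $\mathbf{k}$-vector space, $\cdot$ and $\ast$ are bilinear operations $A\otimes A\to A$, and $\alpha\colon A\to A$ is a linear map (the twisting map). It is multiplicative if $\alpha(x\cdot y)=\alpha(x)\cdot\alpha(y)$ and $\alpha(x\ast y)=\alpha(x)\ast\alpha(y)$ for all $x,y$. A weak morphism $\beta\colon A\to A$ is a linear map with $\beta(x\cdot y)=\beta(x)\cdot\beta(y)$ and $\beta(x\ast y)=\beta(x)\ast\beta(y)$ for all $x,y$. A morphism $\beta\colon A\to A$ is a weak morphism such that $\beta\alpha=\alpha\beta$. Here $\beta\alpha$ denotes composition. A Hom-Novikov-Poisson algebra is a double Hom-algebra $(A,\cdot,\ast,\alpha)$ such that for all $x,y,z\in A$: (1) $(A,\cdot,\alpha)$ is a commutative Hom-associative algebra: $x\cdot y=y\cdot x$ and $(x\cdot y)\cdot\alpha(z)=\alpha(x)\cdot(y\cdot z)$; (2) $(A,\ast,\alpha)$ is a Hom-Novikov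 algebra: $(x\ast y)\ast\alpha(z)-\alpha(x)\ast(y\ast z)=(y\ast x)\ast\alpha(z)-\alpha(y)\ast(x\ast z)$ and $(x\ast y)\ast\alpha(z)=(x\ast z)\ast\alpha(y)$; (3) $(x\ast y)\cdot\alpha(z)-\alpha(x)\ast(y\cdot z)=(y\ast x)\cdot\alpha(z)-\alpha(y)\ast(x\cdot z)$; (4) $(x\cdot y)\ast\alpha(z)=(x\ast z)\cdot\alpha(y)$. *)

theory Defs
  imports Complex_Main
begin

text \<open>
  A vector space over a field of characteristic \<open>0\<close> is a type \<open>'a::ab_group_add\<close> with a scalar
  multiplication \<open>scale :: 'k::field_char_0 \<Rightarrow> 'a \<Rightarrow> 'a\<close> satisfying the library locale
  \<open>vector_space\<close>. A bilinear operation \<open>A \<otimes> A \<rightarrow> A\<close> is a binary function that is linear in each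
  argument.
\<close>

locale hom_algebra = vector_space scale
  for scale :: "'k::field_char_0 \<Rightarrow> 'a::ab_group_add \<Rightarrow> 'a" +
  fixes mult :: "'a \<Rightarrow> 'a \<Rightarrow> 'a" (infixl "\<odot>" 70)
    and \<alpha> :: "'a \<Rightarrow> 'a"
  assumes linear_left: "Vector_Spaces.linear scale scale (\<lambda>x. x \<odot> y)"
    and linear_right: "Vector_Spaces.linear scale scale (\<lambda>y. x \<odot> y)"
    and linear_twist: "Vector_Spaces.linear scale scale \<alpha>"

locale comm_hom_associative_algebra = hom_algebra scale mult \<alpha>
  for scale :: "'k::field_char_0 \<Rightarrow> 'a::ab_group_add \<Rightarrow> 'a"
    and mult :: "'a \<Rightarrow> 'a \<Rightarrow> 'a" (infixl "\<odot>" 70)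
    and \<alpha> :: "'a \<Rightarrow> 'a" +
  assumes commute: "x \<odot> y = y \<odot> x"
    and hom_assoc: "(x \<odot> y) \<odot> \<alpha> z = \<alpha> x \<odot> (y \<odot> z)"

locale hom_novikov_algebra = hom_algebra scale mult \<alpha>
  for scale :: "'k::field_char_0 \<Rightarrow> 'a::ab_group_add \<Rightarrow> 'a"
    and mult :: "'a \<Rightarrow> 'a \<Rightarrow> 'a" (infixl "\<odot>" 70)
    and \<alpha> :: "'a \<Rightarrow> 'a" +
  assumes left_symmetric:
      "(x \<odot> y) \<odot> \<alpha> z - \<alpha> x \<odot> (y \<odot> z) = (y \<odot> x) \<odot> \<alpha> z - \<alpha> y \<odot> (x \<odot> z)"
    and right_commute: "(x \<odot> y) \<odot> \<alpha> z = (x \<odot> z) \<odot> \<alpha> y"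

locale double_hom_algebra =
  dot: hom_algebra scale dot \<alpha> + ast: hom_algebra scale ast \<alpha>
  for scale :: "'k::field_char_0 \<Rightarrow> 'a::ab_group_add \<Rightarrow> 'a"
    and dot :: "'a \<Rightarrow> 'a \<Rightarrow> 'a" (infixl "\<cdot>" 70)
    and ast :: "'a \<Rightarrow> 'a \<Rightarrow> 'a" (infixl "\<ast>" 70)
    and \<alpha> :: "'a \<Rightarrow> 'a"

locale multiplicative_double_hom_algebra = double_hom_algebra scale dot ast \<alpha>
  for scale :: "'k::field_char_0 \<Rightarrow> 'a::ab_group_add \<Rightarrow> 'a"
    and dot :: "'a \<Rightarrow> 'a \<Rightarrow> 'a" (infixl "\<cdot>" 70)
    and ast :: "'a \<Rightarrow> 'a \<Rightarrow> 'a" (infixl "\<ast>" 70)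
    and \<alpha> :: "'a \<Rightarrow> 'a" +
  assumes twist_dot: "\<alpha> (x \<cdot> y) = \<alpha> x \<cdot> \<alpha> y"
    and twist_ast: "\<alpha> (x \<ast> y) = \<alpha> x \<ast> \<alpha> y"

locale weak_morphism = double_hom_algebra scale dot ast \<alpha>
  for scale :: "'k::field_char_0 \<Rightarrow> 'a::ab_group_add \<Rightarrow> 'a"
    and dot :: "'a \<Rightarrow> 'a \<Rightarrow> 'a" (infixl "\<cdot>" 70)
    and ast :: "'a \<Rightarrow> 'a \<Rightarrow> 'a" (infixl "\<ast>" 70)
    and \<alpha> :: "'a \<Rightarrow> 'a" +
  fixes \<beta> :: "'a \<Rightarrow> 'a"
  assumes linear_morphism: "Vector_Spaces.linear scale scale \<beta>"
    and morphism_dot: "\<beta> (x \<cdot> y) = \<beta> x \<cdot> \<beta> y"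
    and morphism_ast: "\<beta> (x \<ast> y) = \<beta> x \<ast> \<beta> y"

locale morphism = weak_morphism scale dot ast \<alpha> \<beta>
  for scale :: "'k::field_char_0 \<Rightarrow> 'a::ab_group_add \<Rightarrow> 'a"
    and dot :: "'a \<Rightarrow> 'a \<Rightarrow> 'a" (infixl "\<cdot>" 70)
    and ast :: "'a \<Rightarrow> 'a \<Rightarrow> 'a" (infixl "\<ast>" 70)
    and \<alpha> \<beta> :: "'a \<Rightarrow> 'a" +
  assumes morphism_twist: "\<beta> \<circ> \<alpha> = \<alpha> \<circ> \<beta>"

locale hom_novikov_poisson_algebra = double_hom_algebra scale dot ast \<alpha> +
  dot: comm_hom_associative_algebra scale dot \<alpha> + ast: hom_novikov_algebra scale ast \<alpha>
  for scale :: "'k::field_char_0 \<Rightarrow> 'a::ab_group_add \<Rightarrow> 'a"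
    and dot :: "'a \<Rightarrow> 'a \<Rightarrow> 'a" (infixl "\<cdot>" 70)
    and ast :: "'a \<Rightarrow> 'a \<Rightarrow> 'a" (infixl "\<ast>" 70)
    and \<alpha> :: "'a \<Rightarrow> 'a" +
  assumes left_compatible:
      "(x \<ast> y) \<cdot> \<alpha> z - \<alpha> x \<ast> (y \<cdot> z) = (y \<ast> x) \<cdot> \<alpha> z - \<alpha> y \<ast> (x \<cdot> z)"
    and right_compatible: "(x \<cdot> y) \<ast> \<alpha> z = (x \<ast> z) \<cdot> \<alpha> y"

end

theory Submission
  imports Defs
begin

text \<open>
  Every monomial in the axioms of a Hom-Novikov-Poisson algebra is built from two products and one
  application of \<open>\<alpha>\<close>, placed on the factor that the inner product leaves out. After twisting, such a
  monomial becomes \<open>\<beta> (\<beta> (x y) \<beta> (\<alpha> z))\<close> or its mirror image, possibly with a different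
  operation inside and outside. As \<open>\<beta>\<close> preserves both operations, this is \<open>\<beta> (\<beta> ((x y) \<alpha> z))\<close>:
  each twisted monomial is the image of the original one under \<open>\<beta> \<circ> \<beta>\<close>. Since \<open>\<beta>\<close> is additive,
  each twisted axiom is then the image of the original axiom under \<open>\<beta> \<circ> \<beta>\<close>. Commutativity of the
  first operation involves a single product and is obtained by applying \<open>\<beta>\<close> once.

  The relation \<open>\<beta> \<alpha> = \<alpha> \<beta>\<close> enters only for multiplicativity, where \<open>\<beta> \<circ> \<alpha>\<close> has to be moved past the
  \<open>\<beta>\<close> in the twisted product.
\<close>

lemma hom_algebra_twist:
  assumes "hom_algebra scale mult \<alpha>"
    and "Vector_Spaces.linear scale scale \<beta>"
  shows "hom_algebra scale (\<lambda>x y. \<beta> (mult x y)) (\<beta> \<circ> \<alpha>)"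
proof -
  interpret hom_algebra scale mult \<alpha> by fact
  show ?thesis
  proof (intro hom_algebra.intro hom_algebra_axioms.intro vector_space_axioms)
    show "Vector_Spaces.linear scale scale (\<lambda>x. \<beta> (mult x y))" for y
      using Vector_Spaces.linear_compose[OF linear_left assms(2)] by (simp add: o_def)
    show "Vector_Spaces.linear scale scale (\<lambda>y. \<beta> (mult x y))" for x
      using Vector_Spaces.linear_compose[OF linear_right assms(2)] by (simp add: o_def)
    show "Vector_Spaces.linear scale scale (\<beta> \<circ> \<alpha>)"
      by (rule Vector_Spaces.linear_compose[OF linear_twist assms(2)])
  qed
qed

lemma comm_hom_associative_algebra_twist:
  assumes "comm_hom_associative_algebra scale mult \<alpha>"
    and "Vector_Spaces.linear scale scale \<beta>"
    and hom: "\<And>x y. \<beta> (mult x y) = mult (\<beta> x) (\<beta> y)"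
  shows "comm_hom_associative_algebra scale (\<lambda>x y. \<beta> (mult x y)) (\<beta> \<circ> \<alpha>)"
proof -
  interpret comm_hom_associative_algebra scale mult \<alpha> by fact
  interpret twisted: hom_algebra scale "\<lambda>x y. \<beta> (mult x y)" "\<beta> \<circ> \<alpha>"
    by (rule hom_algebra_twist[OF hom_algebra_axioms assms(2)])
  show ?thesis
  proof unfold_locales
    show "\<beta> (mult x y) = \<beta> (mult y x)" for x y
      by (simp only: commute)
    show "\<beta> (mult (\<beta> (mult x y)) ((\<beta> \<circ> \<alpha>) z)) = \<beta> (mult ((\<beta> \<circ> \<alpha>) x) (\<beta> (mult y z)))" for x y z
      by (simp only: o_apply hom[symmetric] hom_assoc)
  qed
qed

lemma hom_novikov_algebra_twist:
  assumes "hom_novikov_algebra scale mult \<alpha>"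
    and "Vector_Spaces.linear scale scale \<beta>"
    and hom: "\<And>x y. \<beta> (mult x y) = mult (\<beta> x) (\<beta> y)"
  shows "hom_novikov_algebra scale (\<lambda>x y. \<beta> (mult x y)) (\<beta> \<circ> \<alpha>)"
proof -
  interpret hom_novikov_algebra scale mult \<alpha> by fact
  interpret \<beta>: Vector_Spaces.linear scale scale \<beta> by fact
  interpret twisted: hom_algebra scale "\<lambda>x y. \<beta> (mult x y)" "\<beta> \<circ> \<alpha>"
    by (rule hom_algebra_twist[OF hom_algebra_axioms assms(2)])
  show ?thesis
  proof unfold_locales
    show "\<beta> (mult (\<beta> (mult x y)) ((\<beta> \<circ> \<alpha>) z)) - \<beta> (mult ((\<beta> \<circ> \<alpha>) x) (\<beta> (mult y z)))
        = \<beta> (mult (\<beta> (mult y x)) ((\<beta> \<circ> \<alpha>) z)) - \<beta> (mult ((\<beta> \<circ> \<alpha>) y) (\<beta> (mult x z)))" for x y z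
      by (simp only: o_apply hom[symmetric] \<beta>.diff[symmetric] left_symmetric[of x y z])
    show "\<beta> (mult (\<beta> (mult x y)) ((\<beta> \<circ> \<alpha>) z)) = \<beta> (mult (\<beta> (mult x z)) ((\<beta> \<circ> \<alpha>) y))" for x y z
      by (simp only: o_apply hom[symmetric] right_commute[of x y z])
  qed
qed

lemma double_hom_algebra_twist:
  assumes "weak_morphism scale dot ast \<alpha> \<beta>"
  shows "double_hom_algebra scale (\<lambda>x y. \<beta> (dot x y)) (\<lambda>x y. \<beta> (ast x y)) (\<beta> \<circ> \<alpha>)"
proof -
  interpret weak_morphism scale dot ast \<alpha> \<beta> by fact
  show ?thesis
    by (intro double_hom_algebra.intro hom_algebra_twist linear_morphism
        dot.hom_algebra_axioms ast.hom_algebra_axioms)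
qed

lemma hom_novikov_poisson_algebra_twist:
  assumes "hom_novikov_poisson_algebra scale dot ast \<alpha>"
    and "weak_morphism scale dot ast \<alpha> \<beta>"
  shows "hom_novikov_poisson_algebra scale (\<lambda>x y. \<beta> (dot x y)) (\<lambda>x y. \<beta> (ast x y)) (\<beta> \<circ> \<alpha>)"
proof -
  interpret A: hom_novikov_poisson_algebra scale dot ast \<alpha> by fact
  interpret weak_morphism scale dot ast \<alpha> \<beta> by fact
  interpret \<beta>: Vector_Spaces.linear scale scale \<beta> by (rule linear_morphism)
  \<comment> \<open>Used in this direction, the morphism laws collect both copies of \<open>\<beta>\<close> on the outside and leave the
    untwisted axiom as their argument.\<close>
  note pull_out = o_apply morphism_dot[symmetric] morphism_ast[symmetric] \<beta>.diff[symmetric]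
  show ?thesis
  proof (intro hom_novikov_poisson_algebra.intro hom_novikov_poisson_algebra_axioms.intro)
    show "double_hom_algebra scale (\<lambda>x y. \<beta> (dot x y)) (\<lambda>x y. \<beta> (ast x y)) (\<beta> \<circ> \<alpha>)"
      by (rule double_hom_algebra_twist) fact
    show "comm_hom_associative_algebra scale (\<lambda>x y. \<beta> (dot x y)) (\<beta> \<circ> \<alpha>)"
      by (intro comm_hom_associative_algebra_twist A.dot.comm_hom_associative_algebra_axioms
          linear_morphism morphism_dot)
    show "hom_novikov_algebra scale (\<lambda>x y. \<beta> (ast x y)) (\<beta> \<circ> \<alpha>)"
      by (intro hom_novikov_algebra_twist A.ast.hom_novikov_algebra_axioms
          linear_morphism morphism_ast)
    show "\<beta> (dot (\<beta> (ast x y)) ((\<beta> \<circ> \<alpha>) z)) - \<beta> (ast ((\<beta> \<circ> \<alpha>) x) (\<beta> (dot y z)))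
        = \<beta> (dot (\<beta> (ast y x)) ((\<beta> \<circ> \<alpha>) z)) - \<beta> (ast ((\<beta> \<circ> \<alpha>) y) (\<beta> (dot x z)))" for x y z
      by (simp only: pull_out A.left_compatible[of x y z])
    show "\<beta> (ast (\<beta> (dot x y)) ((\<beta> \<circ> \<alpha>) z)) = \<beta> (dot (\<beta> (ast x z)) ((\<beta> \<circ> \<alpha>) y))" for x y z
      by (simp only: pull_out A.right_compatible[of x y z])
  qed
qed

lemma multiplicative_double_hom_algebra_twist:
  assumes "multiplicative_double_hom_algebra scale dot ast \<alpha>"
    and "morphism scale dot ast \<alpha> \<beta>"
  shows "multiplicative_double_hom_algebra scale
    (\<lambda>x y. \<beta> (dot x y)) (\<lambda>x y. \<beta> (ast x y)) (\<beta> \<circ> \<alpha>)"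
proof -
  interpret A: multiplicative_double_hom_algebra scale dot ast \<alpha> by fact
  interpret morphism scale dot ast \<alpha> \<beta> by fact
  have twist_commutes: "\<alpha> (\<beta> x) = \<beta> (\<alpha> x)" for x
    by (rule fun_cong[OF morphism_twist, unfolded o_apply, symmetric])
  show ?thesis
  proof (intro multiplicative_double_hom_algebra.intro
      multiplicative_double_hom_algebra_axioms.intro)
    show "double_hom_algebra scale (\<lambda>x y. \<beta> (dot x y)) (\<lambda>x y. \<beta> (ast x y)) (\<beta> \<circ> \<alpha>)"
      by (rule double_hom_algebra_twist[OF weak_morphism_axioms])
    show "(\<beta> \<circ> \<alpha>) (\<beta> (dot x y)) = \<beta> (dot ((\<beta> \<circ> \<alpha>) x) ((\<beta> \<circ> \<alpha>) y))" for x y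
      by (simp only: o_apply twist_commutes A.twist_dot morphism_dot)
    show "(\<beta> \<circ> \<alpha>) (\<beta> (ast x y)) = \<beta> (ast ((\<beta> \<circ> \<alpha>) x) ((\<beta> \<circ> \<alpha>) y))" for x y
      by (simp only: o_apply twist_commutes A.twist_ast morphism_ast)
  qed
qed

theorem theorem2p11:
  fixes scale :: "'k::field_char_0 \<Rightarrow> 'a::ab_group_add \<Rightarrow> 'a"
    and dot :: "'a \<Rightarrow> 'a \<Rightarrow> 'a" (infixl "\<cdot>" 70)
    and ast :: "'a \<Rightarrow> 'a \<Rightarrow> 'a" (infixl "\<ast>" 70)
    and \<alpha> \<beta> :: "'a \<Rightarrow> 'a"
  assumes "hom_novikov_poisson_algebra scale (\<cdot>) (\<ast>) \<alpha>"
    and "weak_morphism scale (\<cdot>) (\<ast>) \<alpha> \<beta>"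
  shows "hom_novikov_poisson_algebra scale (\<lambda>x y. \<beta> (x \<cdot> y)) (\<lambda>x y. \<beta> (x \<ast> y)) (\<beta> \<circ> \<alpha>)
    \<and> (multiplicative_double_hom_algebra scale (\<cdot>) (\<ast>) \<alpha> \<and> morphism scale (\<cdot>) (\<ast>) \<alpha> \<beta> \<longrightarrow>
        multiplicative_double_hom_algebra scale
          (\<lambda>x y. \<beta> (x \<cdot> y)) (\<lambda>x y. \<beta> (x \<ast> y)) (\<beta> \<circ> \<alpha>))"
  using hom_novikov_poisson_algebra_twist[OF assms]
    multiplicative_double_hom_algebra_twist[of scale dot ast \<alpha> \<beta>]
  by blast

end
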